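(* Let $D$ be an integral domain with quotient field $K$, and suppose $D = \bigcap_\alpha D_{P_\alpha}$ where $\{P_\alpha\}$ is a set of nonzero prime ideals of $D$. Let $\star$ be the star-operation on $F(D)$ defined by $A^\star = \bigcap_\alpha A D_{P_\alpha}$. Then the following are equivalent: (1) The map $A \mapsto \bigcap_\alpha AD_{P_\alpha} = A^\star$ has finite character. (2) For every $A \in F(D)$, $A^\star = D$ implies that there exists a finitely generated ideal $B \subseteq A$ with $B^\star = D$. (3) If $A$ is an ideal of $D$ with $A \nsubseteq P_\alpha$ for each $\alpha$, then there exists a finitely generated ideal $B \subseteq A$ with $B \nsubseteq P_\alpha$ for each $\alpha$.
   Context: $K^\ast = K\setminus\{0\}$. A fractional ideal of $D$ is a $D$-submodule $A$ of $K$ with $xA \subseteq D$ for some nonzero $x \in D$. $F(D)$ is the set of nonzero fractional ideals of $D$, and $f(D)$ the set of nonzero finitely generated fractional ideals. $D_{P}\subseteq K$ denotes the localization of $D$ at the prime ideal $P$. A star-operation on $F(D)$ is a map $\star: F(D) \to F(D)$, $A \mapsto A^\star$, such that for all $A,B \in F(D)$ and $a \in K^\ast$: (1) $(a)^\star = (a)$ and $(aA)^\star = aA^\star$; (2) $A \subseteq A^\star$, and $A \subseteq B$ implies $A^\star \subseteq B^\star$; (3) $(A^\star)^\star = A^\star$. A star-operation $\star$ has finite character if $A^\star = \bigcup\{B^\star \mid B \in f(D),\ B \subseteq A\}$ for every $A \in F(D)$. *)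

theory Defs
  imports "HOL-Algebra.Algebra"
begin

text \<open>An integral domain with its quotient field is a pair of a field \<open>K\<close> and a subring \<open>D\<close>
  of \<open>K\<close> such that every element of \<open>K\<close> is a fraction of elements of \<open>D\<close>.  As a ring of its own,
  \<open>D\<close> is \<open>K\<lparr>carrier := D\<rparr>\<close>.\<close>

locale domain_with_quotient_field = field K for D and K (structure) +
  assumes subdomain: "subdomain D K"
    and fraction: "x \<in> carrier K \<Longrightarrow> \<exists>a\<in>D. \<exists>b\<in>D - {\<zero>}. x = a \<otimes> inv b"

definition field_as_module :: "('a, 'b) ring_scheme \<Rightarrow> ('a, 'a) module" where
  "field_as_module K =
     \<lparr>carrier = carrier K, monoid.mult = monoid.mult K, one = one K,
      ring.zero = ring.zero K, ring.add = ring.add K, smult = monoid.mult K\<rparr>"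

abbreviation submodule_of_field :: "('a, 'b) ring_scheme \<Rightarrow> 'a set \<Rightarrow> 'a set \<Rightarrow> bool" where
  "submodule_of_field K D A \<equiv> submodule A (K\<lparr>carrier := D\<rparr>) (field_as_module K)"

text \<open>The sets \<open>F(D)\<close> and \<open>f(D)\<close> of nonzero (finitely generated) fractional ideals.
  The translate \<open>xA\<close> is the left coset \<open>x <#\<^bsub>K\<^esub> A\<close>.\<close>

definition fractional_ideals :: "('a, 'b) ring_scheme \<Rightarrow> 'a set \<Rightarrow> 'a set set" where
  "fractional_ideals K D =
     {A. submodule_of_field K D A \<and> A \<noteq> {\<zero>\<^bsub>K\<^esub>} \<and>
         (\<exists>x\<in>D - {\<zero>\<^bsub>K\<^esub>}. x <#\<^bsub>K\<^esub> A \<subseteq> D)}"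

definition generated_submodule :: "('a, 'b) ring_scheme \<Rightarrow> 'a set \<Rightarrow> 'a set \<Rightarrow> 'a set" where
  "generated_submodule K D S = \<Inter>{N. submodule_of_field K D N \<and> S \<subseteq> N}"

definition fg_fractional_ideals :: "('a, 'b) ring_scheme \<Rightarrow> 'a set \<Rightarrow> 'a set set" where
  "fg_fractional_ideals K D =
     {A \<in> fractional_ideals K D.
        \<exists>S\<subseteq>carrier K. finite S \<and> A = generated_submodule K D S}"

definition fg_ideal :: "'a set \<Rightarrow> ('a, 'b) ring_scheme \<Rightarrow> bool" where
  "fg_ideal B R \<longleftrightarrow> ideal B R \<and> (\<exists>S\<subseteq>carrier R. finite S \<and> B = genideal R S)"

definition star_operation ::
    "('a, 'b) ring_scheme \<Rightarrow> 'a set \<Rightarrow> ('a set \<Rightarrow> 'a set) \<Rightarrow> bool" where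
  "star_operation K D star \<longleftrightarrow>
     (\<forall>A\<in>fractional_ideals K D. star A \<in> fractional_ideals K D) \<and>
     (\<forall>a\<in>carrier K - {\<zero>\<^bsub>K\<^esub>}. star (a <#\<^bsub>K\<^esub> D) = a <#\<^bsub>K\<^esub> D) \<and>
     (\<forall>a\<in>carrier K - {\<zero>\<^bsub>K\<^esub>}. \<forall>A\<in>fractional_ideals K D.
        star (a <#\<^bsub>K\<^esub> A) = a <#\<^bsub>K\<^esub> star A) \<and>
     (\<forall>A\<in>fractional_ideals K D. A \<subseteq> star A) \<and>
     (\<forall>A\<in>fractional_ideals K D. \<forall>B\<in>fractional_ideals K D. A \<subseteq> B \<longrightarrow> star A \<subseteq> star B) \<and>
     (\<forall>A\<in>fractional_ideals K D. star (star A) = star A)"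

definition has_finite_character ::
    "('a, 'b) ring_scheme \<Rightarrow> 'a set \<Rightarrow> ('a set \<Rightarrow> 'a set) \<Rightarrow> bool" where
  "has_finite_character K D star \<longleftrightarrow>
     (\<forall>A\<in>fractional_ideals K D.
        star A = \<Union>{star B | B. B \<in> fg_fractional_ideals K D \<and> B \<subseteq> A})"

definition localization :: "('a, 'b) ring_scheme \<Rightarrow> 'a set \<Rightarrow> 'a set \<Rightarrow> 'a set" where
  "localization K D P = {a \<otimes>\<^bsub>K\<^esub> inv\<^bsub>K\<^esub> s | a s. a \<in> D \<and> s \<in> D - P}"

text \<open>\<^const>\<open>ideal_prod\<close> \<open>K A B\<close> is the set of finite sums of products \<open>a \<otimes> b\<close> with \<open>a \<in> A\<close>,
  \<open>b \<in> B\<close>; this makes sense for arbitrary subsets \<open>A\<close>, \<open>B\<close> of \<open>K\<close> and here gives the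
  product \<open>A D\<^sub>P\<close>.  Intersections are taken inside \<open>K\<close>, so that the intersection over the
  empty family is \<open>K\<close>.\<close>

definition local_star ::
    "('a, 'b) ring_scheme \<Rightarrow> 'a set \<Rightarrow> 'a set set \<Rightarrow> 'a set \<Rightarrow> 'a set" where
  "local_star K D \<P> A = carrier K \<inter> (\<Inter>P\<in>\<P>. ideal_prod K A (localization K D P))"


subsection \<open>The map \<^const>\<open>local_star\<close> is a star-operation\<close>

context domain_with_quotient_field
begin

lemmas D_sub = subdomainE(1)[OF subdomain]
lemmas D_closed = subdomainE(2,3,5-7)[OF subdomain]

lemma D_carr [simp]: "x \<in> D \<Longrightarrow> x \<in> carrier K"
  using D_sub by blast

lemma nonzero_inv:
  assumes "a \<in> carrier K" "a \<noteq> \<zero>"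
  shows "inv a \<in> carrier K" "a \<otimes> inv a = \<one>" "inv a \<otimes> a = \<one>" "inv a \<noteq> \<zero>"
proof -
  have U: "a \<in> Units K" using assms by (simp add: field_Units)
  show "inv a \<in> carrier K" "a \<otimes> inv a = \<one>" "inv a \<otimes> a = \<one>" using U by auto
  then show "inv a \<noteq> \<zero>" using assms by (metis r_null one_not_zero)
qed

lemma submodule_iff:
  "submodule_of_field K D A \<longleftrightarrow>
     A \<subseteq> carrier K \<and> \<zero> \<in> A \<and> (\<forall>x\<in>A. \<forall>y\<in>A. x \<oplus> y \<in> A) \<and> (\<forall>d\<in>D. \<forall>x\<in>A. d \<otimes> x \<in> A)"
  (is "?L \<longleftrightarrow> ?R")
proof
  assume ?L
  then show ?R
    unfolding submodule_def submodule_axioms_def subgroup_def field_as_module_def by auto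
next
  assume R: ?R
  have inv_eq: "inv\<^bsub>add_monoid (field_as_module K)\<^esub> x = \<ominus> x" for x
    unfolding field_as_module_def a_inv_def m_inv_def by simp
  have "\<ominus> x \<in> A" if "x \<in> A" for x
  proof -
    have "\<ominus> \<one> \<otimes> x \<in> A" using R that D_closed by auto
    then show ?thesis using R that by (metis l_minus l_one one_closed subsetD)
  qed
  then show ?L
    using R unfolding submodule_def submodule_axioms_def subgroup_def inv_eq
    by (auto simp: field_as_module_def)
qed

lemma prime_facts:
  assumes "primeideal P (K\<lparr>carrier := D\<rparr>)"
  shows "P \<subseteq> D" "\<zero> \<in> P" "\<one> \<notin> P"
    and "\<And>s t. s \<in> D - P \<Longrightarrow> t \<in> D - P \<Longrightarrow> s \<otimes> t \<in> D - P"
proof -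
  interpret P: primeideal P "K\<lparr>carrier := D\<rparr>" by fact
  show "P \<subseteq> D" using P.a_subset by simp
  show "\<zero> \<in> P" using additive_subgroup.zero_closed[OF P.is_additive_subgroup] by simp
  show "\<one> \<notin> P" using P.one_imp_carrier P.I_notcarr by auto
  show "\<And>s t. s \<in> D - P \<Longrightarrow> t \<in> D - P \<Longrightarrow> s \<otimes> t \<in> D - P"
    using P.I_prime D_closed by auto
qed

lemma mem_localization_iff:
  assumes "primeideal P (K\<lparr>carrier := D\<rparr>)"
  shows "x \<in> localization K D P \<longleftrightarrow> x \<in> carrier K \<and> (\<exists>s\<in>D - P. s \<otimes> x \<in> D)"
proof
  assume "x \<in> localization K D P"
  then obtain a s where as: "x = a \<otimes> inv s" "a \<in> D" "s \<in> D - P"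
    unfolding localization_def by auto
  then have s: "s \<in> carrier K" "s \<noteq> \<zero>" using prime_facts[OF assms] by auto
  have "s \<otimes> x = a"
    using as s nonzero_inv[OF s] by (metis D_carr m_comm m_assoc r_one)
  then show "x \<in> carrier K \<and> (\<exists>s\<in>D - P. s \<otimes> x \<in> D)"
    using as s nonzero_inv[OF s] by (metis D_carr m_closed)
next
  assume "x \<in> carrier K \<and> (\<exists>s\<in>D - P. s \<otimes> x \<in> D)"
  then obtain s where x: "x \<in> carrier K" and s: "s \<in> D - P" "s \<otimes> x \<in> D" by blast
  then have s': "s \<in> carrier K" "s \<noteq> \<zero>" using prime_facts[OF assms] by auto
  have "x = (s \<otimes> x) \<otimes> inv s"
    using x s' nonzero_inv[OF s'] by (metis m_comm m_assoc l_one m_closed)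
  then show "x \<in> localization K D P"
    unfolding localization_def using s by blast
qed

lemma mem_ideal_prod_iff:
  assumes P: "primeideal P (K\<lparr>carrier := D\<rparr>)" and A: "submodule_of_field K D A"
  shows "x \<in> ideal_prod K A (localization K D P) \<longleftrightarrow>
           x \<in> carrier K \<and> (\<exists>s\<in>D - P. s \<otimes> x \<in> A)"
proof
  note A' = A[unfolded submodule_iff] and P' = prime_facts[OF P]
  assume "x \<in> ideal_prod K A (localization K D P)"
  then show "x \<in> carrier K \<and> (\<exists>s\<in>D - P. s \<otimes> x \<in> A)"
  proof (induction rule: ideal_prod.induct)
    case (prod a y)
    then obtain s where s: "y \<in> carrier K" "s \<in> D - P" "s \<otimes> y \<in> D"
      using mem_localization_iff[OF P] by blast
    have a: "a \<in> carrier K" using A' prod by blast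
    have "s \<otimes> (a \<otimes> y) = (s \<otimes> y) \<otimes> a"
      using s a by (metis D_carr DiffD1 m_comm m_assoc)
    then have "s \<otimes> (a \<otimes> y) \<in> A" using A' prod s by auto
    then show ?case using s a by auto
  next
    case (sum x y)
    then obtain s t where st: "s \<in> D - P" "s \<otimes> x \<in> A" "t \<in> D - P" "t \<otimes> y \<in> A" by blast
    have c: "s \<in> carrier K" "t \<in> carrier K" "x \<in> carrier K" "y \<in> carrier K"
      using st sum by auto
    have "(s \<otimes> t) \<otimes> (x \<oplus> y) = t \<otimes> (s \<otimes> x) \<oplus> s \<otimes> (t \<otimes> y)"
      using c by (simp add: r_distr m_ac)
    moreover have "t \<otimes> (s \<otimes> x) \<in> A" "s \<otimes> (t \<otimes> y) \<in> A" using A' st by auto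
    ultimately have "(s \<otimes> t) \<otimes> (x \<oplus> y) \<in> A" using A' by auto
    then show ?case using c P'(4) st by blast
  qed
next
  note P' = prime_facts[OF P]
  assume "x \<in> carrier K \<and> (\<exists>s\<in>D - P. s \<otimes> x \<in> A)"
  then obtain s where x: "x \<in> carrier K" and s: "s \<in> D - P" "s \<otimes> x \<in> A" by blast
  then have s': "s \<in> carrier K" "s \<noteq> \<zero>" using P' by auto
  have "x = (s \<otimes> x) \<otimes> (\<one> \<otimes> inv s)"
    using x s' nonzero_inv[OF s'] by (metis m_comm m_assoc l_one m_closed)
  moreover have "\<one> \<otimes> inv s \<in> localization K D P"
    unfolding localization_def using s D_closed by blast
  ultimately show "x \<in> ideal_prod K A (localization K D P)"
    using s by (metis ideal_prod.prod)
qed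

lemma mem_local_star_iff:
  assumes "\<And>P. P \<in> \<P> \<Longrightarrow> primeideal P (K\<lparr>carrier := D\<rparr>)" and "submodule_of_field K D A"
  shows "x \<in> local_star K D \<P> A \<longleftrightarrow> x \<in> carrier K \<and> (\<forall>P\<in>\<P>. \<exists>s\<in>D - P. s \<otimes> x \<in> A)"
  unfolding local_star_def using mem_ideal_prod_iff[OF assms(1) assms(2)] by auto

lemma submodule_translate:
  assumes A: "submodule_of_field K D A" and a: "a \<in> carrier K"
  shows "submodule_of_field K D (a <# A)"
proof -
  note A' = A[unfolded submodule_iff]
  have c: "x \<in> carrier K" if "x \<in> A" for x using A' that by blast
  have "a \<otimes> x \<oplus> a \<otimes> y \<in> a <# A" if "x \<in> A" "y \<in> A" for x y
  proof -
    have "a \<otimes> x \<oplus> a \<otimes> y = a \<otimes> (x \<oplus> y)" using a c that by (simp add: r_distr)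
    then show ?thesis using A' that unfolding l_coset_def by auto
  qed
  moreover have "d \<otimes> (a \<otimes> x) \<in> a <# A" if "d \<in> D" "x \<in> A" for d x
  proof -
    have "d \<otimes> (a \<otimes> x) = a \<otimes> (d \<otimes> x)" using a c that by (simp add: m_lcomm)
    then show ?thesis using A' that unfolding l_coset_def by auto
  qed
  moreover have "\<zero> \<in> a <# A"
    using A' a unfolding l_coset_def by (auto intro!: bexI[of _ \<zero>])
  moreover have "a <# A \<subseteq> carrier K" using a c unfolding l_coset_def by auto
  ultimately show ?thesis unfolding submodule_iff by (auto simp: l_coset_def)
qed

lemma mem_translate_iff:
  assumes "a \<in> carrier K - {\<zero>}" "A \<subseteq> carrier K" "x \<in> carrier K"
  shows "x \<in> a <# A \<longleftrightarrow> inv a \<otimes> x \<in> A"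
proof
  have i: "a \<in> carrier K" "inv a \<in> carrier K" "a \<otimes> inv a = \<one>" "inv a \<otimes> a = \<one>"
    using assms nonzero_inv by auto
  {
    assume "x \<in> a <# A"
    then obtain y where "y \<in> A" "x = a \<otimes> y" unfolding l_coset_def by auto
    moreover have "inv a \<otimes> (a \<otimes> y) = y" if "y \<in> A" for y
      using that assms(2) i by (metis m_assoc l_one subsetD)
    ultimately show "inv a \<otimes> x \<in> A" by simp
  next
    assume *: "inv a \<otimes> x \<in> A"
    have "x = a \<otimes> (inv a \<otimes> x)" using assms(3) i by (metis m_assoc l_one)
    then show "x \<in> a <# A" using * unfolding l_coset_def by auto
  }
qed

theorem local_star_is_star_operation:
  assumes prime: "\<And>P. P \<in> \<P> \<Longrightarrow> primeideal P (K\<lparr>carrier := D\<rparr>)"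
    and D_eq: "D = carrier K \<inter> (\<Inter>P\<in>\<P>. localization K D P)"
  shows "star_operation K D (local_star K D \<P>)"
proof -
  let ?s = "local_star K D \<P>"
  have mem: "x \<in> ?s A \<longleftrightarrow> x \<in> carrier K \<and> (\<forall>P\<in>\<P>. \<exists>s\<in>D - P. s \<otimes> x \<in> A)"
    if "submodule_of_field K D A" for x A
    using mem_local_star_iff[OF prime that] .
  note pf = prime_facts[OF prime]
  have F: "submodule_of_field K D A" "A \<subseteq> carrier K" if "A \<in> fractional_ideals K D" for A
    using that unfolding fractional_ideals_def by (auto simp: submodule_iff)
  have D_mem: "x \<in> D" if "x \<in> carrier K" "\<And>P. P \<in> \<P> \<Longrightarrow> \<exists>s\<in>D - P. s \<otimes> x \<in> D" for x
  proof -
    have "x \<in> localization K D P" if "P \<in> \<P>" for P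
      using mem_localization_iff[OF prime[OF that]] \<open>x \<in> carrier K\<close>
        \<open>\<And>P. P \<in> \<P> \<Longrightarrow> \<exists>s\<in>D - P. s \<otimes> x \<in> D\<close> that by blast
    then show ?thesis using D_eq \<open>x \<in> carrier K\<close> by blast
  qed
  have D_sm: "submodule_of_field K D D"
    unfolding submodule_iff using D_closed D_sub by auto
  have one: "\<one> \<in> D - P" if "P \<in> \<P>" for P using pf(3)[OF that] D_closed by auto
  have ext: "A \<subseteq> ?s A" if A: "submodule_of_field K D A" for A
  proof
    fix x assume x: "x \<in> A"
    have "x \<in> carrier K" using A x by (auto simp: submodule_iff)
    then show "x \<in> ?s A" using mem[OF A] one x by (metis l_one)
  qed
  have sm: "submodule_of_field K D (?s A)" if A: "submodule_of_field K D A" for A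
  proof -
    note A' = A[unfolded submodule_iff]
    have "x \<oplus> y \<in> ?s A" if xy: "x \<in> ?s A" "y \<in> ?s A" for x y
    proof -
      have c: "x \<in> carrier K" "y \<in> carrier K" using xy mem[OF A] by auto
      have "\<exists>s\<in>D - P. s \<otimes> (x \<oplus> y) \<in> A" if P: "P \<in> \<P>" for P
      proof -
        obtain s t where st: "s \<in> D - P" "s \<otimes> x \<in> A" "t \<in> D - P" "t \<otimes> y \<in> A"
          using xy mem[OF A] P by meson
        have c': "s \<in> carrier K" "t \<in> carrier K" using st by auto
        have "(s \<otimes> t) \<otimes> (x \<oplus> y) = t \<otimes> (s \<otimes> x) \<oplus> s \<otimes> (t \<otimes> y)"
          using c c' by (simp add: r_distr m_ac)
        moreover have "t \<otimes> (s \<otimes> x) \<in> A" "s \<otimes> (t \<otimes> y) \<in> A" using A' st by auto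
        ultimately have "(s \<otimes> t) \<otimes> (x \<oplus> y) \<in> A" using A' by auto
        then show ?thesis using pf(4)[OF P] st by blast
      qed
      then show ?thesis using mem[OF A] c by auto
    qed
    moreover have "d \<otimes> x \<in> ?s A" if d: "d \<in> D" and x: "x \<in> ?s A" for d x
    proof -
      have c: "x \<in> carrier K" "d \<in> carrier K" using x d mem[OF A] by auto
      have "\<exists>s\<in>D - P. s \<otimes> (d \<otimes> x) \<in> A" if P: "P \<in> \<P>" for P
      proof -
        obtain s where s: "s \<in> D - P" "s \<otimes> x \<in> A" using x mem[OF A] P by meson
        have "s \<otimes> (d \<otimes> x) = d \<otimes> (s \<otimes> x)" using c s by (simp add: m_lcomm)
        then show ?thesis using A' d s by (metis (no_types))
      qed
      then show ?thesis using mem[OF A] c by auto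
    qed
    moreover have "\<zero> \<in> ?s A" using ext[OF A] A' by auto
    moreover have "?s A \<subseteq> carrier K" using mem[OF A] by auto
    ultimately show ?thesis unfolding submodule_iff by auto
  qed
  have frac: "?s A \<in> fractional_ideals K D" if A: "A \<in> fractional_ideals K D" for A
  proof -
    note A' = F(1)[OF A]
    obtain x where x: "x \<in> D - {\<zero>}" "x <# A \<subseteq> D"
      using A unfolding fractional_ideals_def by auto
    have "x \<otimes> y \<in> D" if y: "y \<in> ?s A" for y
    proof (rule D_mem)
      have c: "y \<in> carrier K" using y mem[OF A'] by auto
      then show "x \<otimes> y \<in> carrier K" using x by auto
      fix P assume P: "P \<in> \<P>"
      obtain s where s: "s \<in> D - P" "s \<otimes> y \<in> A" using y mem[OF A'] P by meson
      have "s \<otimes> (x \<otimes> y) = x \<otimes> (s \<otimes> y)" using c s x by (simp add: m_lcomm)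
      moreover have "x \<otimes> (s \<otimes> y) \<in> D" using x s unfolding l_coset_def by auto
      ultimately show "\<exists>s\<in>D - P. s \<otimes> (x \<otimes> y) \<in> D" using s by (metis (no_types))
    qed
    then have "x <# ?s A \<subseteq> D" unfolding l_coset_def by auto
    moreover have "?s A \<noteq> {\<zero>}"
    proof
      assume "?s A = {\<zero>}"
      then have "A = {\<zero>}" using ext[OF A'] A' unfolding submodule_iff by auto
      then show False using A unfolding fractional_ideals_def by auto
    qed
    ultimately show ?thesis using sm[OF A'] x unfolding fractional_ideals_def by auto
  qed
  have transl: "?s (a <# A) = a <# ?s A"
    if a: "a \<in> carrier K - {\<zero>}" and A: "submodule_of_field K D A" for a A
  proof -
    have aK: "a \<in> carrier K" "inv a \<in> carrier K" using a nonzero_inv by auto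
    have AK: "A \<subseteq> carrier K" using A by (auto simp: submodule_iff)
    have aA: "submodule_of_field K D (a <# A)" using submodule_translate[OF A] a by auto
    have sK: "?s A \<subseteq> carrier K" unfolding local_star_def by auto
    have saK: "a <# ?s A \<subseteq> carrier K" using sK aK unfolding l_coset_def by auto
    have "x \<in> ?s (a <# A) \<longleftrightarrow> x \<in> a <# ?s A" if x: "x \<in> carrier K" for x
    proof -
      have "s \<otimes> x \<in> a <# A \<longleftrightarrow> s \<otimes> (inv a \<otimes> x) \<in> A" if "s \<in> D" for s
      proof -
        have "inv a \<otimes> (s \<otimes> x) = s \<otimes> (inv a \<otimes> x)" using that x aK by (simp add: m_lcomm)
        then show ?thesis using mem_translate_iff[OF a AK, of "s \<otimes> x"] that x by simp
      qed
      then have "x \<in> ?s (a <# A) \<longleftrightarrow> (\<forall>P\<in>\<P>. \<exists>s\<in>D - P. s \<otimes> (inv a \<otimes> x) \<in> A)"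
        using x by (simp add: mem[OF aA] Bex_def cong: conj_cong)
      also have "\<dots> \<longleftrightarrow> x \<in> a <# ?s A"
        using x aK by (simp add: mem_translate_iff[OF a sK x] mem[OF A])
      finally show ?thesis .
    qed
    moreover have "?s (a <# A) \<subseteq> carrier K" unfolding local_star_def by auto
    ultimately show ?thesis using saK by (meson subset_antisym subsetD subsetI)
  qed
  have sD: "?s D = D"
  proof
    show "?s D \<subseteq> D"
    proof
      fix x assume "x \<in> ?s D"
      then show "x \<in> D" unfolding mem[OF D_sm] by (intro D_mem) auto
    qed
  qed (rule ext[OF D_sm])
  have idem: "?s (?s A) = ?s A" if A: "submodule_of_field K D A" for A
  proof
    show "?s A \<subseteq> ?s (?s A)" using ext[OF sm[OF A]] .
    show "?s (?s A) \<subseteq> ?s A"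
    proof
      fix x assume x: "x \<in> ?s (?s A)"
      then have c: "x \<in> carrier K" using mem[OF sm[OF A]] by auto
      have "\<exists>s\<in>D - P. s \<otimes> x \<in> A" if P: "P \<in> \<P>" for P
      proof -
        obtain s where s: "s \<in> D - P" "s \<otimes> x \<in> ?s A" using x mem[OF sm[OF A]] P by meson
        then obtain t where t: "t \<in> D - P" "t \<otimes> (s \<otimes> x) \<in> A" using mem[OF A] P by meson
        have "(t \<otimes> s) \<otimes> x \<in> A" using s t c by (simp add: m_assoc)
        then show ?thesis using pf(4)[OF P] s t by blast
      qed
      then show "x \<in> ?s A" using mem[OF A] c by auto
    qed
  qed
  have mono: "?s A \<subseteq> ?s B"
    if "submodule_of_field K D A" "submodule_of_field K D B" "A \<subseteq> B" for A B
  proof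
    fix x assume "x \<in> ?s A"
    then show "x \<in> ?s B" unfolding mem[OF that(1)] mem[OF that(2)] using that(3) by (meson subsetD)
  qed
  show ?thesis
    unfolding star_operation_def
  proof (intro conjI ballI impI)
    fix a assume a: "a \<in> carrier K - {\<zero>}"
    show "?s (a <# D) = a <# D" using transl[OF a D_sm] unfolding sD .
    fix A assume "A \<in> fractional_ideals K D"
    show "?s (a <# A) = a <# ?s A" using transl[OF a F(1)] \<open>A \<in> fractional_ideals K D\<close> .
  next
    fix A assume A: "A \<in> fractional_ideals K D"
    show "?s A \<in> fractional_ideals K D" using frac[OF A] .
    show "A \<subseteq> ?s A" using ext[OF F(1)[OF A]] .
    show "?s (?s A) = ?s A" using idem[OF F(1)[OF A]] .
    fix B assume B: "B \<in> fractional_ideals K D" and "A \<subseteq> B"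
    show "?s A \<subseteq> ?s B" using mono[OF F(1)[OF A] F(1)[OF B] \<open>A \<subseteq> B\<close>] .
  qed
qed

end

end

theory Submission
  imports Defs
begin

text \<open>The only idea is in \<open>(3) \<Longrightarrow> (1)\<close>.  For \<open>x \<in> A\<^sup>\<star>\<close> the conductor \<open>{d \<in> D. d x \<in> A}\<close> lies
  in no \<open>P\<^sub>\<alpha>\<close>, so by (3) the same holds for the ideal generated by some finite subset \<open>S\<close> of it;
  then \<open>x\<close> lies in the closure of the finitely generated submodule \<open>(S x) \<subseteq> A\<close>.
  The rest is the remark that an ideal lies in no \<open>P\<^sub>\<alpha>\<close> iff \<open>1\<close> is in its closure.\<close>

context domain_with_quotient_field
begin

text \<open>Apart from negation, the axioms on the two sides match. Ideals, fractional ideals and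
  generated submodules can then all be treated by \<open>submodule_iff\<close>.\<close>

lemma ideal_iff_submodule:

  \<comment> \<open>Ideals of \<open>D\<close> viewed as submodules of \<open>K\<close>\<close>
  "ideal I (K\<lparr>carrier := D\<rparr>) \<longleftrightarrow> I \<subseteq> D \<and> submodule_of_field K D I"
proof
  assume "ideal I (K\<lparr>carrier := D\<rparr>)"
  then interpret I: ideal I "K\<lparr>carrier := D\<rparr>" .
  show "I \<subseteq> D \<and> submodule_of_field K D I"
    using I.a_subset I.I_l_closed D_sub
      additive_subgroup.zero_closed[OF I.is_additive_subgroup]
      additive_subgroup.a_closed[OF I.is_additive_subgroup]
    unfolding submodule_iff by auto
next
  assume I: "I \<subseteq> D \<and> submodule_of_field K D I"
  note I' = conjunct2[OF I, unfolded submodule_iff]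
  interpret R: domain "K\<lparr>carrier := D\<rparr>"
    using subdomain_iff[OF D_sub] subdomain by simp
  \<comment> \<open>Negation in the subring is a definite description over \<open>D\<close>, not
    literally that of \<open>K\<close>. Writing it as multiplication by the subring's own minus one,
    an element of \<open>D\<close>, reduces it to closure under scalars.\<close>
  have minus: "\<ominus>\<^bsub>K\<lparr>carrier := D\<rparr>\<^esub> x \<in> I" if "x \<in> I" for x
  proof -
    have "\<ominus>\<^bsub>K\<lparr>carrier := D\<rparr>\<^esub> x = \<ominus>\<^bsub>K\<lparr>carrier := D\<rparr>\<^esub> \<one>\<^bsub>K\<lparr>carrier := D\<rparr>\<^esub> \<otimes> x"
      using R.l_minus[of "\<one>\<^bsub>K\<lparr>carrier := D\<rparr>\<^esub>" x] R.l_one[of x] R.one_closed I that by auto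
    moreover have "\<ominus>\<^bsub>K\<lparr>carrier := D\<rparr>\<^esub> \<one>\<^bsub>K\<lparr>carrier := D\<rparr>\<^esub> \<in> D"
      using R.a_inv_closed[OF R.one_closed] by simp
    ultimately show ?thesis using I' that by simp
  qed
  have "subgroup I (add_monoid (K\<lparr>carrier := D\<rparr>))"
    using I I' minus by (intro R.add.subgroupI) (auto simp: a_inv_def)
  then show "ideal I (K\<lparr>carrier := D\<rparr>)"
  proof (rule idealI[OF R.ring_axioms])
    fix a x assume "a \<in> I" "x \<in> carrier (K\<lparr>carrier := D\<rparr>)"
    then show "x \<otimes>\<^bsub>K\<lparr>carrier := D\<rparr>\<^esub> a \<in> I" "a \<otimes>\<^bsub>K\<lparr>carrier := D\<rparr>\<^esub> x \<in> I"
      using I I' by (auto simp: m_comm[of a x] subsetD)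
  qed
qed

lemma generated_submodule_superset: "S \<subseteq> generated_submodule K D S"
  unfolding generated_submodule_def by auto

lemma generated_submodule_minimal:
  "submodule_of_field K D N \<Longrightarrow> S \<subseteq> N \<Longrightarrow> generated_submodule K D S \<subseteq> N"
  unfolding generated_submodule_def by auto

lemma submodule_carrier: "submodule_of_field K D (carrier K)"
  unfolding submodule_iff by auto

lemma submodule_D: "submodule_of_field K D D"
  unfolding submodule_iff using D_closed D_sub by auto

text \<open>Since \<open>S \<subseteq> carrier K\<close>, the family being intersected contains
  \<open>carrier K\<close>; in particular it is nonempty and the intersection stays inside
  \<open>K\<close>.\<close>

lemma submodule_generated_submodule:
  assumes "S \<subseteq> carrier K"
  shows "submodule_of_field K D (generated_submodule K D S)"
proof -
  have "generated_submodule K D S \<subseteq> carrier K"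
    by (rule generated_submodule_minimal[OF submodule_carrier assms])
  then show ?thesis
    unfolding submodule_iff unfolding generated_submodule_def submodule_iff by auto
qed

text \<open>\<open>D\<close> is itself a submodule containing \<open>S\<close>, so the generated
  submodule lies in \<open>D\<close> and is an ideal. Conversely, every ideal over \<open>S\<close>
  takes part in the intersection of submodules.\<close>

lemma genideal_eq_generated_submodule:
  assumes "S \<subseteq> D"
  shows "genideal (K\<lparr>carrier := D\<rparr>) S = generated_submodule K D S"
proof
  have "generated_submodule K D S \<subseteq> D"
    by (rule generated_submodule_minimal[OF submodule_D assms])
  moreover have "submodule_of_field K D (generated_submodule K D S)"
    using assms D_sub by (intro submodule_generated_submodule) auto
  ultimately have "ideal (generated_submodule K D S) (K\<lparr>carrier := D\<rparr>)"
    by (simp add: ideal_iff_submodule)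
  then show "genideal (K\<lparr>carrier := D\<rparr>) S \<subseteq> generated_submodule K D S"
    unfolding genideal_def using generated_submodule_superset[of S] by auto
  show "generated_submodule K D S \<subseteq> genideal (K\<lparr>carrier := D\<rparr>) S"
    unfolding genideal_def generated_submodule_def ideal_iff_submodule by auto
qed

lemma fg_ideal_iff:
  "fg_ideal B (K\<lparr>carrier := D\<rparr>) \<longleftrightarrow>
     (\<exists>S\<subseteq>D. finite S \<and> B = generated_submodule K D S)" (is "?L \<longleftrightarrow> ?R")
proof
  assume ?L then show ?R
    unfolding fg_ideal_def using genideal_eq_generated_submodule by auto
next
  assume ?R
  then obtain S where S: "S \<subseteq> D" "finite S" "B = generated_submodule K D S" by blast
  then have "ideal B (K\<lparr>carrier := D\<rparr>)"
    using submodule_generated_submodule[of S] D_sub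
      generated_submodule_minimal[OF submodule_D, of S]
    unfolding ideal_iff_submodule by auto
  then show ?L
    unfolding fg_ideal_def using S genideal_eq_generated_submodule by auto
qed

section \<open>Fractional ideals, and ideals contained in no given prime\<close>

lemma fractional_idealD:
  assumes "A \<in> fractional_ideals K D"
  shows "submodule_of_field K D A" "A \<subseteq> carrier K"
  using assms unfolding fractional_ideals_def by (auto simp: submodule_iff)

text \<open>A common denominator of \<open>A\<close> is also one of \<open>B\<close>.\<close>

lemma fractional_ideal_subset:
  assumes "A \<in> fractional_ideals K D" "submodule_of_field K D B" "B \<subseteq> A" "B \<noteq> {\<zero>}"
  shows "B \<in> fractional_ideals K D"
proof -
  obtain x where x: "x \<in> D - {\<zero>}" "x <# A \<subseteq> D"
    using assms(1) unfolding fractional_ideals_def by blast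
  moreover have "x <# B \<subseteq> x <# A" using assms(3) unfolding l_coset_def by blast
  ultimately show ?thesis using assms unfolding fractional_ideals_def by blast
qed

lemma D_fractional: "D \<in> fractional_ideals K D"
proof -
  have "\<one> \<in> D - {\<zero>}" using D_closed one_not_zero by simp
  moreover have "\<one> <# D \<subseteq> D" unfolding l_coset_def by auto
  moreover have "D \<noteq> {\<zero>}" using calculation(1) by blast
  ultimately show ?thesis using submodule_D unfolding fractional_ideals_def by blast
qed

lemma ideal_fractional:
  assumes "ideal I (K\<lparr>carrier := D\<rparr>)" "I \<noteq> {\<zero>}"
  shows "I \<in> fractional_ideals K D"
  using assms fractional_ideal_subset[OF D_fractional] unfolding ideal_iff_submodule by auto

text \<open>At \<open>\<one>\<close>, the multiplier \<open>s\<close> outside \<open>P\<close> with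
  \<open>s \<otimes> \<one> \<in> I\<close> is just an element of \<open>I\<close> outside
  \<open>P\<close>. This translates between condition (3) and closures.\<close>

lemma one_mem_local_star_iff:
  assumes "\<And>P. P \<in> \<P> \<Longrightarrow> primeideal P (K\<lparr>carrier := D\<rparr>)" "ideal I (K\<lparr>carrier := D\<rparr>)"
  shows "\<one> \<in> local_star K D \<P> I \<longleftrightarrow> (\<forall>P\<in>\<P>. \<not> I \<subseteq> P)"
proof -
  have I: "I \<subseteq> D" "submodule_of_field K D I"
    using assms(2) by (auto simp: ideal_iff_submodule)
  have "(\<exists>s\<in>D - P. s \<otimes> \<one> \<in> I) \<longleftrightarrow> \<not> I \<subseteq> P" for P
    using I(1) by auto
  then show ?thesis
    using mem_local_star_iff[OF assms(1) I(2)] by auto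
qed

text \<open>Serves twice in (3) => (1): the conductor into \<open>A\<close> is the ideal to which
  (3) is applied, and the conductor into the finitely generated \<open>B\<close> absorbs the ideal
  that (3) yields.\<close>

lemma ideal_conductor:
  assumes A: "submodule_of_field K D A" and x: "x \<in> carrier K"
  shows "ideal {d \<in> D. d \<otimes> x \<in> A} (K\<lparr>carrier := D\<rparr>)"
proof -
  note A' = A[unfolded submodule_iff]
  have "(d \<oplus> e) \<otimes> x \<in> A" if "d \<in> D" "d \<otimes> x \<in> A" "e \<in> D" "e \<otimes> x \<in> A" for d e
    using A' that x by (simp add: l_distr)
  moreover have "(d \<otimes> e) \<otimes> x \<in> A" if "d \<in> D" "e \<in> D" "e \<otimes> x \<in> A" for d e
    using A' that x by (simp add: m_assoc)
  moreover have "\<zero> \<otimes> x \<in> A" using A' x by simp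
  ultimately show ?thesis
    unfolding ideal_iff_submodule submodule_iff mem_Collect_eq
    by (intro conjI ballI subsetI) (use D_closed in auto)
qed

lemma fractional_ideal_ne_zero:
  assumes "A \<in> fractional_ideals K D"
  obtains a where "a \<in> A" "a \<noteq> \<zero>"
proof -
  have "\<zero> \<in> A" "A \<noteq> {\<zero>}"
    using assms unfolding fractional_ideals_def submodule_iff by auto
  then show thesis using that by blast
qed

section \<open>The closure for a fixed family of primes\<close>

context
  fixes \<P>
  assumes prime: "\<And>P. P \<in> \<P> \<Longrightarrow> primeideal P (K\<lparr>carrier := D\<rparr>)"
    and D_eq: "D = carrier K \<inter> (\<Inter>P\<in>\<P>. localization K D P)"
begin

lemmas star = local_star_is_star_operation[OF prime D_eq, unfolded star_operation_def]

lemma local_star_fractional: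
  assumes A: "A \<in> fractional_ideals K D"
  shows "local_star K D \<P> A \<in> fractional_ideals K D"
    and "A \<subseteq> local_star K D \<P> A"
    and "B \<in> fractional_ideals K D \<Longrightarrow> A \<subseteq> B \<Longrightarrow> local_star K D \<P> A \<subseteq> local_star K D \<P> B"
  using star A by simp_all

text \<open>Principal fractional ideals are closed, and \<open>D\<close> is the one generated by
  \<open>\<one>\<close>.\<close>

lemma local_star_D: "local_star K D \<P> D = D"
proof -
  have "\<one> <# D = D" unfolding l_coset_def by auto
  moreover have "\<one> \<in> carrier K - {\<zero>}" using one_not_zero by simp
  ultimately show ?thesis
    using conjunct1[OF conjunct2[OF star]] by metis
qed

text \<open>Monotonicity and \<open>local_star_D\<close> bound the closure by \<open>D\<close>;
  being a submodule, it contains all of \<open>D\<close> as soon as it contains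
  \<open>\<one>\<close>.\<close>

lemma local_star_eq_D_iff:
  assumes "I \<in> fractional_ideals K D" "I \<subseteq> D"
  shows "local_star K D \<P> I = D \<longleftrightarrow> \<one> \<in> local_star K D \<P> I"
proof
  assume one: "\<one> \<in> local_star K D \<P> I"
  have "d \<in> local_star K D \<P> I" if "d \<in> D" for d
    using fractional_idealD(1)[OF local_star_fractional(1)[OF assms(1)]] one that
    unfolding submodule_iff by (metis D_carr r_one)
  moreover have "local_star K D \<P> I \<subseteq> D"
    using local_star_fractional(3)[OF assms(1) D_fractional assms(2)] local_star_D by simp
  ultimately show "local_star K D \<P> I = D" by auto
qed (use D_closed in auto)

section \<open>The implications (1) => (2) => (3) => (1)\<close>

text \<open>Finite character is applied to the single element \<open>\<one>\<close> of the closure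
  of \<open>A\<close>.\<close>

lemma finite_character_imp_fg_closure_D:
  assumes fin: "has_finite_character K D (local_star K D \<P>)"
    and A: "A \<in> fractional_ideals K D" "local_star K D \<P> A = D"
  shows "\<exists>B. fg_ideal B (K\<lparr>carrier := D\<rparr>) \<and> B \<in> fractional_ideals K D \<and> B \<subseteq> A \<and>
           local_star K D \<P> B = D"
proof -
  have "\<one> \<in> local_star K D \<P> A" using A D_closed by auto
  then obtain B where B: "B \<in> fg_fractional_ideals K D" "B \<subseteq> A" "\<one> \<in> local_star K D \<P> B"
    using fin A(1) unfolding has_finite_character_def by blast
  \<comment> \<open>Here \<open>A\<close> lies in its closure \<open>D\<close>, so \<open>B\<close>
    is an ideal with generators in \<open>D\<close>, not merely a fractional one.\<close>
  have BD: "B \<subseteq> D" using B(2) local_star_fractional(2)[OF A(1)] A(2) by auto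
  obtain S where S: "finite S" "B = generated_submodule K D S"
    using B(1) unfolding fg_fractional_ideals_def by auto
  have "S \<subseteq> D" using S generated_submodule_superset[of S] BD by auto
  then have "fg_ideal B (K\<lparr>carrier := D\<rparr>)" using S fg_ideal_iff by auto
  moreover have "B \<in> fractional_ideals K D" using B(1) unfolding fg_fractional_ideals_def by auto
  ultimately show ?thesis using B BD local_star_eq_D_iff by blast
qed

lemma fg_closure_D_imp_fg_avoiding:
  assumes fg: "\<And>A. A \<in> fractional_ideals K D \<Longrightarrow> local_star K D \<P> A = D \<Longrightarrow>
      \<exists>B. fg_ideal B (K\<lparr>carrier := D\<rparr>) \<and> B \<in> fractional_ideals K D \<and> B \<subseteq> A \<and>
          local_star K D \<P> B = D"
    and A: "ideal A (K\<lparr>carrier := D\<rparr>)" "\<forall>P\<in>\<P>. \<not> A \<subseteq> P"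
  shows "\<exists>B. fg_ideal B (K\<lparr>carrier := D\<rparr>) \<and> B \<subseteq> A \<and> (\<forall>P\<in>\<P>. \<not> B \<subseteq> P)"
proof (cases "A = {\<zero>}")
  \<comment> \<open>Zero lies in every prime, so this case forces \<open>\<P> = {}\<close>. The zero
    ideal is not in F(D), so \<open>fg\<close> does not apply; but it is generated by the empty set
    and can itself serve as \<open>B\<close>.\<close>
  case True
  have "generated_submodule K D {} = {\<zero>}"
    using generated_submodule_minimal[of "{\<zero>}" "{}"] submodule_generated_submodule[of "{}"]
      D_sub by (auto simp: submodule_iff)
  then have "fg_ideal A (K\<lparr>carrier := D\<rparr>)"
    using True unfolding fg_ideal_iff by (metis empty_subsetI finite.emptyI)
  then show ?thesis using A(2) by blast
next
  case False
  have AF: "A \<in> fractional_ideals K D" using ideal_fractional[OF A(1) False] .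
  have "local_star K D \<P> A = D"
    using local_star_eq_D_iff[OF AF] one_mem_local_star_iff[OF prime A(1)] A
    by (simp add: ideal_iff_submodule)
  then obtain B where B: "fg_ideal B (K\<lparr>carrier := D\<rparr>)" "B \<subseteq> A" "local_star K D \<P> B = D"
    using fg[OF AF] by blast
  have "\<one> \<in> local_star K D \<P> B" using B(3) D_closed by auto
  then show ?thesis
    using one_mem_local_star_iff[OF prime] B unfolding fg_ideal_def by blast
qed

lemma fg_avoiding_imp_finite_character:
  assumes fg: "\<And>A. ideal A (K\<lparr>carrier := D\<rparr>) \<Longrightarrow> \<forall>P\<in>\<P>. \<not> A \<subseteq> P \<Longrightarrow>
      \<exists>B. fg_ideal B (K\<lparr>carrier := D\<rparr>) \<and> B \<subseteq> A \<and> (\<forall>P\<in>\<P>. \<not> B \<subseteq> P)"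
  shows "has_finite_character K D (local_star K D \<P>)"
  unfolding has_finite_character_def
proof (intro ballI equalityI subsetI)
  fix A x assume A: "A \<in> fractional_ideals K D" and xs: "x \<in> local_star K D \<P> A"
  note As = fractional_idealD[OF A]
  have x: "x \<in> carrier K" "\<And>P. P \<in> \<P> \<Longrightarrow> \<exists>s\<in>D - P. s \<otimes> x \<in> A"
    using xs mem_local_star_iff[OF prime As(1)] by auto
  \<comment> \<open>Each multiplier provided by \<open>x(2)\<close> is a conductor element outside
    \<open>P\<close>.\<close>
  have "\<forall>P\<in>\<P>. \<not> {d \<in> D. d \<otimes> x \<in> A} \<subseteq> P" using x(2) by blast
  then obtain J where J: "fg_ideal J (K\<lparr>carrier := D\<rparr>)" "J \<subseteq> {d \<in> D. d \<otimes> x \<in> A}"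
      "\<forall>P\<in>\<P>. \<not> J \<subseteq> P"
    using fg[OF ideal_conductor[OF As(1) x(1)]] by blast
  obtain S where S: "S \<subseteq> D" "finite S" "J = generated_submodule K D S"
    using J(1) fg_ideal_iff by auto
  obtain a where a: "a \<in> A" "a \<noteq> \<zero>" using fractional_ideal_ne_zero[OF A] .
  \<comment> \<open>The nonzero generator \<open>a\<close> keeps \<open>B\<close> nonzero when \<open>x = \<zero>\<close>, or when \<open>\<P> = {}\<close> and \<open>J = {\<zero>}\<close>.\<close>
  define T where "T = insert a ((\<lambda>s. s \<otimes> x) ` S)"
  define B where "B = generated_submodule K D T"
  have TA: "T \<subseteq> A"
    using a J(2) S(3) generated_submodule_superset[of S] unfolding T_def by auto
  have BA: "B \<subseteq> A" unfolding B_def by (rule generated_submodule_minimal[OF As(1) TA])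
  have B: "submodule_of_field K D B"
    unfolding B_def using TA As(2) by (intro submodule_generated_submodule) auto
  have TB: "T \<subseteq> B" unfolding B_def by (rule generated_submodule_superset)
  then have "B \<noteq> {\<zero>}" using a unfolding T_def by auto
  then have "B \<in> fractional_ideals K D" using fractional_ideal_subset[OF A B BA] by simp
  then have "B \<in> fg_fractional_ideals K D"
    unfolding fg_fractional_ideals_def using S(2) TA As(2) B_def T_def by blast
  moreover have "x \<in> local_star K D \<P> B"
  proof -
    have "submodule_of_field K D {d \<in> D. d \<otimes> x \<in> B}"
      using ideal_conductor[OF B x(1)] by (simp add: ideal_iff_submodule)
    moreover have "S \<subseteq> {d \<in> D. d \<otimes> x \<in> B}" using TB S(1) unfolding T_def by auto
    \<comment> \<open>The elements of \<open>J\<close> outside a given \<open>P\<close> need not be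
      generators, so the inclusion must pass from \<open>S\<close> to all of
      \<open>J\<close>.\<close>
    ultimately have "J \<subseteq> {d \<in> D. d \<otimes> x \<in> B}"
      unfolding S(3) by (rule generated_submodule_minimal)
    then have "\<exists>s\<in>D - P. s \<otimes> x \<in> B" if "P \<in> \<P>" for P using J(3) that by blast
    then show ?thesis using mem_local_star_iff[OF prime B] x(1) by auto
  qed
  ultimately show "x \<in> \<Union>{local_star K D \<P> B |B. B \<in> fg_fractional_ideals K D \<and> B \<subseteq> A}"
    using BA by blast
next
  fix A x assume A: "A \<in> fractional_ideals K D"
    and "x \<in> \<Union>{local_star K D \<P> B |B. B \<in> fg_fractional_ideals K D \<and> B \<subseteq> A}"
  then obtain B where "B \<in> fractional_ideals K D" "B \<subseteq> A" "x \<in> local_star K D \<P> B"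
    unfolding fg_fractional_ideals_def by blast
  \<comment> \<open>This inclusion is only monotonicity of the closure.\<close>
  then show "x \<in> local_star K D \<P> A" using local_star_fractional(3)[OF _ A] by blast
qed

end

end

theorem theorem3p3:
  fixes K :: "('a, 'b) ring_scheme" (structure)
    and D :: "'a set" and \<P> :: "'a set set"
  assumes "domain_with_quotient_field D K"
    and "\<And>P. P \<in> \<P> \<Longrightarrow> primeideal P (K\<lparr>carrier := D\<rparr>) \<and> P \<noteq> {\<zero>}"
    and "D = carrier K \<inter> (\<Inter>P\<in>\<P>. localization K D P)"
  shows "let star = local_star K D \<P>;
             cond1 = has_finite_character K D star;
             cond2 = (\<forall>A\<in>fractional_ideals K D. star A = D \<longrightarrow>
               (\<exists>B. fg_ideal B (K\<lparr>carrier := D\<rparr>) \<and> B \<in> fractional_ideals K D \<and> B \<subseteq> A \<and> star B = D));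
             cond3 = (\<forall>A. ideal A (K\<lparr>carrier := D\<rparr>) \<and> (\<forall>P\<in>\<P>. \<not> A \<subseteq> P) \<longrightarrow>
               (\<exists>B. fg_ideal B (K\<lparr>carrier := D\<rparr>) \<and> B \<subseteq> A \<and> (\<forall>P\<in>\<P>. \<not> B \<subseteq> P)))
         in (cond1 \<longleftrightarrow> cond2) \<and> (cond2 \<longleftrightarrow> cond3)"
proof -
  interpret domain_with_quotient_field D K by fact
  have prime: "\<And>P. P \<in> \<P> \<Longrightarrow> primeideal P (K\<lparr>carrier := D\<rparr>)" using assms(2) by blast
  note 12 = finite_character_imp_fg_closure_D[OF prime assms(3)]
    and 23 = fg_closure_D_imp_fg_avoiding[OF prime assms(3)]
    and 31 = fg_avoiding_imp_finite_character[OF prime assms(3)]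
  show ?thesis
    unfolding Let_def
  \<comment> \<open>The two implications against the cycle are composites: (2) => (1) passes through
    (3), and (3) => (2) passes through (1).\<close>
  proof (intro conjI iffI, goal_cases)
    case 1 then show ?case using 12 by blast
  next
    case 2 show ?case
    proof (rule 31)
      fix A assume "ideal A (K\<lparr>carrier := D\<rparr>)" "\<forall>P\<in>\<P>. \<not> A \<subseteq> P"
      then show "\<exists>B. fg_ideal B (K\<lparr>carrier := D\<rparr>) \<and> B \<subseteq> A \<and> (\<forall>P\<in>\<P>. \<not> B \<subseteq> P)"
        using 2 by (intro 23) blast+
    qed
  next
    case 3 show ?case
    proof (intro allI impI)
      fix A assume "ideal A (K\<lparr>carrier := D\<rparr>) \<and> (\<forall>P\<in>\<P>. \<not> A \<subseteq> P)"
      then show "\<exists>B. fg_ideal B (K\<lparr>carrier := D\<rparr>) \<and> B \<subseteq> A \<and> (\<forall>P\<in>\<P>. \<not> B \<subseteq> P)"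
        using 3 by (intro 23) blast+
    qed
  next
    case 4
    have "has_finite_character K D (local_star K D \<P>)"
      by (rule 31) (assumption, rule 4[THEN spec, THEN mp, OF conjI])
    then show ?case using 12 by blast
  qed
qed

end
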